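(* Let $(\Gamma,d)$ be a metric arc, i.e. a metric space homeomorphic to $[0,1]$. Then $\Gamma$ admits a Lipschitz mixer if and only if $\Gamma$ has bounded turning.
   Context: For a metric space $(X,d)$, the power $X^n$ carries the metric $d(a,b)=\sum_{k=1}^n d(a_k,b_k)$. A map $f\colon X\to Y$ of metric spaces is Lipschitz if there is a constant $L$ with $d_Y(f(a),f(b))\le L\,d_X(a,b)$ for all $a,b\in X$. A mixer on $X$ is a continuous map $\sigma\colon X^3\to X$ such that $\sigma(a,a,b)=\sigma(a,b,a)=\sigma(b,a,a)=a$ for all $a,b\in X$. A Lipschitz mixer is a mixer that is a Lipschitz map. A metric space $X$ has bounded turning if there exists a constant $C$ such that any two points $a,b\in X$ are contained in some compact connected set $E\subset X$ with $\operatorname{diam}E\le C\,d(a,b)$. *)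

theory Defs
  imports "HOL-Analysis.Analysis"
begin

text \<open>
  A metric space is a subset of a type of class \<open>metric_space\<close>, with the restricted distance.
\<close>

definition metric_arc :: "'a::metric_space set \<Rightarrow> bool" where
  "metric_arc X \<longleftrightarrow> X homeomorphic {0..1::real}"

text \<open>
  The cube of a metric space carries the sum of the coordinate distances. The library's \<open>dist\<close>
  on product types is instead the Euclidean combination of the coordinate distances (it induces
  the same topology), so the sum distance is introduced separately and the Lipschitz condition
  takes the distances as parameters.
\<close>

definition dist3 :: "'a::metric_space \<times> 'a \<times> 'a \<Rightarrow> 'a \<times> 'a \<times> 'a \<Rightarrow> real" where
  "dist3 = (\<lambda>(a\<^sub>1, a\<^sub>2, a\<^sub>3) (b\<^sub>1, b\<^sub>2, b\<^sub>3). dist a\<^sub>1 b\<^sub>1 + dist a\<^sub>2 b\<^sub>2 + dist a\<^sub>3 b\<^sub>3)"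

definition lipschitz_map ::
  "'a set \<Rightarrow> ('a \<Rightarrow> 'a \<Rightarrow> real) \<Rightarrow> ('b \<Rightarrow> 'b \<Rightarrow> real) \<Rightarrow> ('a \<Rightarrow> 'b) \<Rightarrow> bool" where
  "lipschitz_map X d d' f \<longleftrightarrow> (\<exists>L. \<forall>a\<in>X. \<forall>b\<in>X. d' (f a) (f b) \<le> L * d a b)"

definition mixer :: "'a::metric_space set \<Rightarrow> ('a \<times> 'a \<times> 'a \<Rightarrow> 'a) \<Rightarrow> bool" where
  "mixer X \<sigma> \<longleftrightarrow>
     \<sigma> \<in> X \<times> X \<times> X \<rightarrow> X \<and>
     continuous_on (X \<times> X \<times> X) \<sigma> \<and>
     (\<forall>a\<in>X. \<forall>b\<in>X. \<sigma> (a, a, b) = a \<and> \<sigma> (a, b, a) = a \<and> \<sigma> (b, a, a) = a)"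

definition lipschitz_mixer :: "'a::metric_space set \<Rightarrow> ('a \<times> 'a \<times> 'a \<Rightarrow> 'a) \<Rightarrow> bool" where
  "lipschitz_mixer X \<sigma> \<longleftrightarrow> mixer X \<sigma> \<and> lipschitz_map (X \<times> X \<times> X) dist3 dist \<sigma>"

definition bounded_turning :: "'a::metric_space set \<Rightarrow> bool" where
  "bounded_turning X \<longleftrightarrow>
     (\<exists>C. \<forall>a\<in>X. \<forall>b\<in>X. \<exists>E\<subseteq>X. a \<in> E \<and> b \<in> E \<and> compact E \<and> connected E \<and>
        diameter E \<le> C * dist a b)"

end

theory Submission imports Defs begin

text \<open>
  Let \<open>\<sigma>\<close> be a mixer with Lipschitz constant \<open>L\<close>. The set of all \<open>\<sigma> (a, b, t)\<close> contains
  \<open>a = \<sigma> (a, b, a)\<close> and \<open>b = \<sigma> (a, b, b)\<close>, and it lies within \<open>L * dist a b\<close> of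
  \<open>a = \<sigma> (a, a, t)\<close>. Conversely, order the arc by a parametrization and take \<open>\<sigma>\<close> to be the
  median. If one argument moves from \<open>a\<close> to \<open>a'\<close>, the median stays put or moves within the subarc
  from \<open>a\<close> to \<open>a'\<close>; every connected set joining \<open>a\<close> to \<open>a'\<close> contains this subarc, so bounded
  turning bounds its diameter by a multiple of \<open>dist a a'\<close>.
\<close>

lemma lipschitz_mixer_imp_bounded_turning:
  fixes X :: "'a::metric_space set"
  assumes "compact X" "connected X" and \<sigma>: "lipschitz_mixer X \<sigma>"
  shows "bounded_turning X"
proof -
  have maps: "\<sigma> \<in> X \<times> X \<times> X \<rightarrow> X" and cont: "continuous_on (X \<times> X \<times> X) \<sigma>"
    and mix: "\<And>a b. a \<in> X \<Longrightarrow> b \<in> X \<Longrightarrow> \<sigma> (a, a, b) = a \<and> \<sigma> (a, b, a) = a \<and> \<sigma> (b, a, a) = a"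
    using \<sigma> by (auto simp: lipschitz_mixer_def mixer_def)
  obtain L where L: "\<And>p q. p \<in> X \<times> X \<times> X \<Longrightarrow> q \<in> X \<times> X \<times> X \<Longrightarrow> dist (\<sigma> p) (\<sigma> q) \<le> L * dist3 p q"
    using \<sigma> unfolding lipschitz_mixer_def lipschitz_map_def by blast
  \<comment> \<open>The factor 2 arises because two points of the image set are compared through
    \<open>a\<close>, each being within \<open>L * dist a b\<close> of it.\<close>
  have "\<exists>E\<subseteq>X. a \<in> E \<and> b \<in> E \<and> compact E \<and> connected E \<and> diameter E \<le> (2 * L) * dist a b"
    if a: "a \<in> X" and b: "b \<in> X" for a b
  proof (intro exI conjI)
    let ?E = "(\<lambda>t. \<sigma> (a, b, t)) ` X"
    have ct: "continuous_on X (\<lambda>t. \<sigma> (a, b, t))"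
      by (rule continuous_on_compose2[OF cont]) (use a b in \<open>auto intro!: continuous_intros\<close>)
    show "?E \<subseteq> X"
      using maps a b by auto
    show "a \<in> ?E" "b \<in> ?E"
      using mix[OF a b] mix[OF b a] a b by (metis image_eqI)+
    show "compact ?E" "connected ?E"
      using ct assms by (auto intro: compact_continuous_image connected_continuous_image)
    have near: "dist (\<sigma> (a, b, t)) a \<le> L * dist a b" if "t \<in> X" for t
      using L[of "(a, b, t)" "(a, a, t)"] mix[OF a that] a b that
      by (simp add: dist3_def dist_commute)
    show "diameter ?E \<le> (2 * L) * dist a b"
    proof -
      have "dist x y \<le> (2 * L) * dist a b" if "x \<in> ?E" "y \<in> ?E" for x y
      proof -
        have "dist x a \<le> L * dist a b" "dist y a \<le> L * dist a b"
          using near that by auto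
        then show ?thesis
          using dist_triangle2[of x y a] by linarith
      qed
      \<comment> \<open>\<open>a \<in> X\<close> makes the set nonempty, so its diameter is a
        genuine supremum.\<close>
      then show ?thesis
        using a unfolding diameter_def by (auto intro!: cSUP_least)
    qed
  qed
  then show ?thesis
    unfolding bounded_turning_def by blast
qed

text \<open>The median of three reals, written as \<open>c\<close> clamped to the interval between
  \<open>a\<close> and \<open>b\<close>.\<close>

definition med3 :: "real \<Rightarrow> real \<Rightarrow> real \<Rightarrow> real" where
  "med3 a b c = max (min a b) (min (max a b) c)"

lemma med3_in: "med3 a b c \<in> {a, b, c}"
  by (auto simp: med3_def max_def min_def)

lemma med3_swap: "med3 b a c = med3 a b c" "med3 a c b = med3 a b c"
  by (auto simp: med3_def max_def min_def)

lemma med3_majority: "med3 a a b = a" "med3 a b a = a" "med3 b a a = a"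
  by (auto simp: med3_def max_def min_def)

lemma continuous_on_med3 [continuous_intros]:
  assumes "continuous_on S f" "continuous_on S g" "continuous_on S h"
  shows "continuous_on S (\<lambda>x. med3 (f x) (g x) (h x))"
  unfolding med3_def by (intro continuous_intros assms)

text \<open>For fixed \<open>b\<close> and \<open>c\<close>, the median is the projection of the
  first argument to the interval between \<open>b\<close> and \<open>c\<close>. If \<open>a\<close>
  and \<open>a'\<close> lie beyond the same end, both project to that end, possibly outside the
  segment; otherwise both projections lie between \<open>a\<close> and \<open>a'\<close>.\<close>

lemma med3_move:
  assumes "med3 a b c \<noteq> med3 a' b c"
  shows "med3 a b c \<in> closed_segment a a'" "med3 a' b c \<in> closed_segment a a'"
  using assms
  by (auto simp: med3_def max_def min_def closed_segment_eq_real_ivl split: if_splits)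

lemma bounded_turning_homeomorphism_dist_le:
  fixes X :: "'a::metric_space set" and g :: "'a \<Rightarrow> real"
  assumes hom: "homeomorphism X S g f" and "bounded_turning X"
  obtains C where
    "\<And>u v p q. u \<in> X \<Longrightarrow> v \<in> X \<Longrightarrow> p \<in> closed_segment (g u) (g v) \<Longrightarrow> q \<in> closed_segment (g u) (g v)
      \<Longrightarrow> dist (f p) (f q) \<le> C * dist u v"
proof -
  obtain C where C: "\<And>a b. a \<in> X \<Longrightarrow> b \<in> X \<Longrightarrow> \<exists>E\<subseteq>X. a \<in> E \<and> b \<in> E \<and> compact E \<and> connected E \<and>
        diameter E \<le> C * dist a b"
    using assms unfolding bounded_turning_def by blast
  show thesis
  proof (rule that)
    fix u v p q
    assume u: "u \<in> X" and v: "v \<in> X"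
      and p: "p \<in> closed_segment (g u) (g v)" and q: "q \<in> closed_segment (g u) (g v)"
    obtain E where E: "E \<subseteq> X" "u \<in> E" "v \<in> E" "compact E" "connected E"
      "diameter E \<le> C * dist u v"
      using C[OF u v] by blast
    have "continuous_on E g"
      using hom E(1) continuous_on_subset homeomorphism_def by blast
    then have "connected (g ` E)"
      using E(5) connected_continuous_image by blast
    \<comment> \<open>Connected sets of reals are convex; applying \<open>f\<close> then puts the
      whole subarc from \<open>u\<close> to \<open>v\<close> inside \<open>E\<close>.\<close>
    then have "closed_segment (g u) (g v) \<subseteq> g ` E"
      using E(2,3) by (intro closed_segment_subset) (auto simp: connected_convex_1)
    then have "f p \<in> E" "f q \<in> E"
      using p q E(1) hom by (auto simp: homeomorphism_def subset_iff)
    then show "dist (f p) (f q) \<le> C * dist u v"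
      using diameter_bounded_bound[of E "f p" "f q"] E(4,6) compact_imp_bounded by fastforce
  qed
qed

lemma bounded_turning_imp_lipschitz_mixer:
  fixes X :: "'a::metric_space set" and g :: "'a \<Rightarrow> real"
  assumes hom: "homeomorphism X S g f" and bt: "bounded_turning X"
  shows "lipschitz_mixer X (\<lambda>(a, b, c). f (med3 (g a) (g b) (g c)))"
proof -
  have g: "continuous_on X g" and f: "continuous_on S f"
    and gS: "\<And>x. x \<in> X \<Longrightarrow> g x \<in> S" and fX: "\<And>t. t \<in> S \<Longrightarrow> f t \<in> X"
    and fg: "\<And>x. x \<in> X \<Longrightarrow> f (g x) = x"
    using hom by (auto simp: homeomorphism_def)
  have medS: "med3 (g a) (g b) (g c) \<in> S" if "a \<in> X" "b \<in> X" "c \<in> X" for a b c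
    using med3_in[of "g a" "g b" "g c"] gS that by auto
  have "continuous_on (X \<times> X \<times> X) (\<lambda>p. f (med3 (g (fst p)) (g (fst (snd p))) (g (snd (snd p)))))"
    by (rule continuous_on_compose2[OF f])
      (auto intro!: continuous_intros continuous_on_compose2[OF g] medS)
  then have mixer: "mixer X (\<lambda>(a, b, c). f (med3 (g a) (g b) (g c)))"
    using fX medS by (auto simp: mixer_def case_prod_unfold med3_majority fg)
  obtain C where C: "\<And>u v p q. u \<in> X \<Longrightarrow> v \<in> X \<Longrightarrow> p \<in> closed_segment (g u) (g v)
      \<Longrightarrow> q \<in> closed_segment (g u) (g v) \<Longrightarrow> dist (f p) (f q) \<le> C * dist u v"
    using bounded_turning_homeomorphism_dist_le[OF hom bt] by blast
  have move: "dist (f (med3 (g u) b c)) (f (med3 (g v) b c)) \<le> C * dist u v"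
    if "u \<in> X" "v \<in> X" for u v b c
  proof (cases "med3 (g u) b c = med3 (g v) b c")
    case True
    \<comment> \<open>The sign of \<open>C\<close> is unknown; taking both points equal to
      \<open>g u\<close> gives \<open>0 \<le> C * dist u v\<close>.\<close>
    then show ?thesis
      using C[OF that, of "g u" "g u"] by simp
  next
    case False
    then show ?thesis
      using C[OF that] med3_move by blast
  qed
  have "dist (f (med3 (g a) (g b) (g c))) (f (med3 (g a') (g b') (g c')))
      \<le> C * (dist a a' + dist b b' + dist c c')"
    if "a \<in> X" "b \<in> X" "c \<in> X" "a' \<in> X" "b' \<in> X" "c' \<in> X" for a b c a' b' c'
  proof -
    \<comment> \<open>The arguments are changed one at a time and the three estimates are added by
      the triangle inequality. Symmetry of the median brings the changing argument to the first
      place, where \<open>move\<close> applies.\<close>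
    have "dist (f (med3 (g a) (g b) (g c))) (f (med3 (g a') (g b) (g c))) \<le> C * dist a a'"
      using move that by blast
    moreover have "dist (f (med3 (g a') (g b) (g c))) (f (med3 (g a') (g b') (g c))) \<le> C * dist b b'"
      using move[of b b' "g a'" "g c"] that by (simp only: med3_swap(1)[of _ "g a'"])
    moreover have "dist (f (med3 (g a') (g b') (g c))) (f (med3 (g a') (g b') (g c'))) \<le> C * dist c c'"
      using move[of c c' "g a'" "g b'"] that by (metis med3_swap)
    ultimately show ?thesis
      unfolding distrib_left by (meson add_mono dist_triangle order_trans)
  qed
  then show ?thesis
    using mixer unfolding lipschitz_mixer_def lipschitz_map_def dist3_def
    by (intro conjI exI[of _ C]) auto
qed

theorem theorem1p1:
  fixes \<Gamma> :: "'a::metric_space set"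
  assumes "metric_arc \<Gamma>"
  shows "(\<exists>\<sigma>. lipschitz_mixer \<Gamma> \<sigma>) \<longleftrightarrow> bounded_turning \<Gamma>"
proof -
  have hom: "\<Gamma> homeomorphic {0..1::real}"
    using assms by (simp add: metric_arc_def)
  then have "compact \<Gamma>" "connected \<Gamma>"
    using homeomorphic_compactness homeomorphic_connectedness connected_Icc[of "0::real" 1] by blast+
  then show ?thesis
    using hom lipschitz_mixer_imp_bounded_turning bounded_turning_imp_lipschitz_mixer
    unfolding homeomorphic_def by metis
qed

end
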